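(* Let $X$ be a treatment variable with $m$ values $x_1,\dots,x_m$ and $Y$ an effect variable with $n$ values $y_1,\dots,y_n$ in a structural causal model. Let $1\le i,k\le n$ with $i\ne k$ and let $1\le j\le m$. Then $P(Y_{x_j}=y_i,\,Y=y_k)$ is bounded below by the maximum of the three quantities $$0,\qquad P(Y_{x_j}=y_i)+P(Y=y_k)-1,$$ $$\sum_{1\le p\le m,\ p\ne j}\max\{0,\ P(Y_{x_j}=y_i)+P(X=x_p,Y=y_k)-1+P(X=x_j)-P(X=x_j,Y=y_i)\},$$ and bounded above by $$\min\{P(Y_{x_j}=y_i)-P(X=x_j,Y=y_i),\ P(Y=y_k)-P(X=x_j,Y=y_k)\}.$$
   Context: $Y_{x_j}$ denotes the counterfactual (potential outcome) variable "the value $Y$ would have, had $X$ been $x_j$". The structural causal model induces one probability space $P$ on which $X$, $Y$, and $Y_{x_1},\dots,Y_{x_m}$ (each with values in $\{y_1,\dots,y_n\}$) are jointly defined, and they satisfy consistency: on the event $X=x_j$ one has $Y_{x_j}=Y$ (so $P(Y_{x_j}=y_i,X=x_j)=P(X=x_j,Y=y_i)$). The values $x_1,\dots,x_m$ are distinct, as are $y_1,\dots,y_n$. *)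

theory Defs
  imports "HOL-Probability.Probability"
begin

end

theory Submission
  imports Defs
begin

text \<open>
  Write \<open>A\<close>, \<open>B\<close> for the events \<open>Y\<^sub>x\<^sub>j = y\<^sub>i\<close>, \<open>Y = y\<^sub>k\<close> and \<open>E\<^sub>p\<close> for \<open>X = x\<^sub>p\<close>. By consistency
  \<open>A \<inter> E\<^sub>j\<close> is the event \<open>X = x\<^sub>j \<and> Y = y\<^sub>i\<close>, so \<open>A \<inter> B\<close> is disjoint from \<open>E\<^sub>j\<close>, which gives the
  upper bound. For \<open>p \<noteq> j\<close> both \<open>A - E\<^sub>j\<close> and \<open>E\<^sub>p \<inter> B\<close> lie in the complement of \<open>E\<^sub>j\<close>; the
  Bonferroni inequality relative to that complement bounds \<open>P(A \<inter> E\<^sub>p \<inter> B)\<close> from below by the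
  \<open>p\<close>-th summand, and these events are disjoint parts of \<open>A \<inter> B\<close>.
\<close>

text \<open>Inclusion-exclusion, with the measure of the union bounded by that of \<open>S\<close>.
  Keeping \<open>S\<close> general serves two uses: the complement of \<open>E j\<close> for the
  summands, and the whole space for the plain bound.\<close>

lemma (in finite_measure) measure_Int_ge:
  assumes "A \<in> sets M" "B \<in> sets M" "S \<in> sets M" "A \<union> B \<subseteq> S"
  shows "measure M A + measure M B - measure M S \<le> measure M (A \<inter> B)"
proof -
  have "measure M (A \<union> B) = measure M A + measure M (B - A)"
    using assms by (simp add: finite_measure_Union')
  moreover have "measure M (B - A) = measure M B - measure M (A \<inter> B)"
    using assms by (simp add: finite_measure_Diff' Int_commute)
  moreover have "measure M (A \<union> B) \<le> measure M S"
    using assms by (intro finite_measure_mono) auto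
  ultimately show ?thesis
    by linarith
qed

lemma (in finite_measure) measure_le_diff:
  assumes "A \<in> sets M" "B \<in> sets M" "S \<in> sets M" "A \<union> B \<subseteq> S" "A \<inter> B = {}"
  shows "measure M A \<le> measure M S - measure M B"
proof -
  have "measure M A + measure M B = measure M (A \<union> B)"
    using assms by (simp add: finite_measure_Union)
  also have "\<dots> \<le> measure M S"
    using assms by (intro finite_measure_mono) auto
  finally show ?thesis
    by linarith
qed

theorem theorem5:
  fixes M :: "'w measure"
    and X :: "'w \<Rightarrow> 'a" and Y :: "'w \<Rightarrow> 'b"
    and Ycf :: "'a \<Rightarrow> 'w \<Rightarrow> 'b"
    and x :: "nat \<Rightarrow> 'a" and y :: "nat \<Rightarrow> 'b"
    and m n i j k :: nat
  assumes "prob_space M"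
    and "inj_on x {1..m}" and "inj_on y {1..n}"
    and "X \<in> M \<rightarrow>\<^sub>M count_space (x ` {1..m})"
    and "Y \<in> M \<rightarrow>\<^sub>M count_space (y ` {1..n})"
    and "\<And>l. l \<in> {1..m} \<Longrightarrow> Ycf (x l) \<in> M \<rightarrow>\<^sub>M count_space (y ` {1..n})"
    and consistency: "\<And>l \<omega>. l \<in> {1..m} \<Longrightarrow> \<omega> \<in> space M \<Longrightarrow> X \<omega> = x l \<Longrightarrow> Ycf (x l) \<omega> = Y \<omega>"
    and "i \<in> {1..n}" and "k \<in> {1..n}" and "i \<noteq> k" and "j \<in> {1..m}"
  shows "Max {0,
              \<P>(\<omega> in M. Ycf (x j) \<omega> = y i) + \<P>(\<omega> in M. Y \<omega> = y k) - 1,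
              (\<Sum>p\<in>{1..m} - {j}.
                 max 0 (\<P>(\<omega> in M. Ycf (x j) \<omega> = y i) + \<P>(\<omega> in M. X \<omega> = x p \<and> Y \<omega> = y k) - 1
                        + \<P>(\<omega> in M. X \<omega> = x j) - \<P>(\<omega> in M. X \<omega> = x j \<and> Y \<omega> = y i)))}
           \<le> \<P>(\<omega> in M. Ycf (x j) \<omega> = y i \<and> Y \<omega> = y k)
         \<and> \<P>(\<omega> in M. Ycf (x j) \<omega> = y i \<and> Y \<omega> = y k)
           \<le> min (\<P>(\<omega> in M. Ycf (x j) \<omega> = y i) - \<P>(\<omega> in M. X \<omega> = x j \<and> Y \<omega> = y i))
                 (\<P>(\<omega> in M. Y \<omega> = y k) - \<P>(\<omega> in M. X \<omega> = x j \<and> Y \<omega> = y k))"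
proof -
  interpret prob_space M by fact
  define A where "A = {\<omega> \<in> space M. Ycf (x j) \<omega> = y i}"
  define B where "B = {\<omega> \<in> space M. Y \<omega> = y k}"
  define E where "E p = {\<omega> \<in> space M. X \<omega> = x p}" for p
  \<comment> \<open>Measurability into \<open>count_space S\<close> speaks only of subsets of
    \<open>S\<close>, hence the condition on \<open>c\<close>.\<close>
  have level: "{\<omega> \<in> space M. f \<omega> = c} \<in> events"
    if "f \<in> M \<rightarrow>\<^sub>M count_space S" "c \<in> S" for f :: "'w \<Rightarrow> 'c" and c S
  proof -
    have "f -` {c} \<inter> space M \<in> events"
      using that by (intro measurable_sets) auto
    also have "f -` {c} \<inter> space M = {\<omega> \<in> space M. f \<omega> = c}"
      by auto
    finally show ?thesis .
  qed
  have A: "A \<in> events"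
    unfolding A_def by (rule level[OF assms(6)]) (use assms in auto)
  have B: "B \<in> events"
    unfolding B_def by (rule level[OF assms(5)]) (use assms in auto)
  have E: "E p \<in> events" if "p \<in> {1..m}" for p
    unfolding E_def by (rule level[OF assms(4)]) (use that in auto)
  note Ej = E[OF \<open>j \<in> {1..m}\<close>]
  have "y i \<noteq> y k"
    using assms by (auto dest: inj_onD)
  have E_disj: "E p \<inter> E q = {}" if "p \<in> {1..m}" "q \<in> {1..m}" "p \<noteq> q" for p q
    using that inj_onD[OF \<open>inj_on x {1..m}\<close>] by (auto simp: E_def)
  have cf: "Ycf (x j) \<omega> = Y \<omega>" if "\<omega> \<in> E j" for \<omega>
    using that consistency[OF \<open>j \<in> {1..m}\<close>] by (auto simp: E_def)
  have XYi: "{\<omega> \<in> space M. X \<omega> = x j \<and> Y \<omega> = y i} = A \<inter> E j"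
    using cf by (auto simp: A_def E_def)
  have XYk: "{\<omega> \<in> space M. X \<omega> = x p \<and> Y \<omega> = y k} = E p \<inter> B" for p
    by (auto simp: B_def E_def)
  have AB: "{\<omega> \<in> space M. Ycf (x j) \<omega> = y i \<and> Y \<omega> = y k} = A \<inter> B"
    by (auto simp: A_def B_def)
  \<comment> \<open>On \<open>E j\<close> consistency makes the counterfactual equal to
    \<open>Y\<close>, which cannot be both \<open>y i\<close> and \<open>y k\<close>.\<close>
  have disj: "A \<inter> B \<inter> E j = {}"
    using cf \<open>y i \<noteq> y k\<close> by (auto simp: A_def B_def)
  have summand: "prob A + prob (E p \<inter> B) - 1 + prob (E j) - prob (A \<inter> E j)
      \<le> prob (A \<inter> B \<inter> E p)" if "p \<in> {1..m} - {j}" for p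
  proof -
    have Ep: "E p \<in> events" and Epj: "E p \<inter> E j = {}"
      using that E E_disj \<open>j \<in> {1..m}\<close> by auto
    have "prob (A - E j) + prob (E p \<inter> B) - prob (space M - E j)
        \<le> prob ((A - E j) \<inter> (E p \<inter> B))"
      using A B Ep Ej Epj sets.sets_into_space[OF A] sets.sets_into_space[OF B]
      by (intro measure_Int_ge) auto
    also have "(A - E j) \<inter> (E p \<inter> B) = A \<inter> B \<inter> E p"
      using Epj by auto
    \<comment> \<open>Since \<open>A - E j\<close> has probability
      \<open>prob A - prob (A \<inter> E j)\<close> and the complement of \<open>E j\<close> has
      \<open>1 - prob (E j)\<close>, the left side is exactly the summand.\<close>
    finally show ?thesis
      using A Ej by (simp add: finite_measure_Diff' prob_compl prob_space)
  qed
  have "(\<Sum>p\<in>{1..m} - {j}.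
          max 0 (prob A + prob (E p \<inter> B) - 1 + prob (E j) - prob (A \<inter> E j)))
      \<le> (\<Sum>p\<in>{1..m} - {j}. prob (A \<inter> B \<inter> E p))"
    \<comment> \<open>Truncation at 0 is harmless, as the bounding probabilities are
      nonnegative.\<close>
    using summand by (intro sum_mono) simp
  also have "\<dots> = prob (\<Union>p\<in>{1..m} - {j}. A \<inter> B \<inter> E p)"
  proof (rule finite_measure_finite_Union[symmetric])
    show "(\<lambda>p. A \<inter> B \<inter> E p) ` ({1..m} - {j}) \<subseteq> events"
      using A B E by auto
    show "disjoint_family_on (\<lambda>p. A \<inter> B \<inter> E p) ({1..m} - {j})"
      unfolding disjoint_family_on_def using E_disj by blast
  qed simp
  also have "\<dots> \<le> prob (A \<inter> B)"
    using A B by (intro finite_measure_mono) auto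
  finally have lower_sum: "(\<Sum>p\<in>{1..m} - {j}.
      max 0 (prob A + prob (E p \<inter> B) - 1 + prob (E j) - prob (A \<inter> E j))) \<le> prob (A \<inter> B)" .
  have lower: "prob A + prob B - 1 \<le> prob (A \<inter> B)"
    using measure_Int_ge[OF A B sets.top] sets.sets_into_space[OF A] sets.sets_into_space[OF B]
    by (simp add: prob_space)
  \<comment> \<open>Inside \<open>A\<close>, the parts \<open>A \<inter> B\<close> and
    \<open>A \<inter> E j\<close> are disjoint by \<open>disj\<close>; the next bound argues the
    same way inside \<open>B\<close>.\<close>
  have upper_A: "prob (A \<inter> B) \<le> prob A - prob (A \<inter> E j)"
    using A B Ej disj by (intro measure_le_diff) auto
  have upper_B: "prob (A \<inter> B) \<le> prob B - prob (E j \<inter> B)"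
    using A B Ej disj by (intro measure_le_diff) auto
  show ?thesis
    unfolding XYi XYk AB A_def[symmetric] B_def[symmetric] E_def[symmetric]
    using lower_sum lower upper_A upper_B by simp
qed

end
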